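(* Let $N\in\mathbb N$, $\lambda>0$, and let the finite node set $\mathcal X\subset\mathbb S^2$ and the weights $\boldsymbol W=\operatorname{diag}(w_{\boldsymbol x})_{\boldsymbol x\in\mathcal X}$ form a quadrature formula that is exact for all spherical harmonics up to polynomial degree $2N$, i.e. $\sum_{\boldsymbol x\in\mathcal X}w_{\boldsymbol x}f(\boldsymbol x)=\int_{\mathbb S^2}f(\boldsymbol x)\,\mathrm d\mu(\boldsymbol x)$ for all such $f$. Then for each $\boldsymbol x\in\mathcal X$ the diagonal entry corresponding to $\boldsymbol x$ of the hat matrix $\boldsymbol H=\boldsymbol F(\boldsymbol F^{\mathsf H}\boldsymbol W\boldsymbol F+\lambda\hat{\boldsymbol W})^{-1}\boldsymbol F^{\mathsf H}\boldsymbol W$ satisfies $$h_{\boldsymbol x,\boldsymbol x}=\frac{w_{\boldsymbol x}}{4\pi}\sum_{n=0}^N\frac{2n+1}{1+\lambda\hat w_n}.$$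
   Context: $\mathbb S^2=\{\boldsymbol x\in\mathbb R^3:\|\boldsymbol x\|_2=1\}$ with surface measure $\mu$ (total mass $4\pi$). $\{Y_{n,k}\}_{n\ge0,\,k=-n,\dots,n}$ are the spherical harmonics ($n$ is the polynomial degree), normalized to form an orthonormal basis of $L_2(\mathbb S^2)$. The Fourier matrix is $\boldsymbol F=[Y_{n,k}(\boldsymbol x)]_{\boldsymbol x\in\mathcal X;\,n=0,\dots,N,\,k=-n,\dots,n}$. The weight matrix in frequency domain is isotropic: $\hat{\boldsymbol W}=\operatorname{diag}(\hat w_{n,k})_{n=0,\dots,N,\,k=-n,\dots,n}$ with $\hat w_{n,k}=\hat w_n$ depending only on $n$. All weights $w_{\boldsymbol x}$ and $\hat w_n$ are strictly positive reals. $^{\mathsf H}$ denotes conjugate transpose. *)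

theory Defs
  imports
    "HOL-Analysis.Analysis"
    "Jordan_Normal_Form.Gauss_Jordan_Elimination"
    "Jordan_Normal_Form.Schur_Decomposition"
begin

no_notation Matrix.vec_index (infixl "$" 100)
hide_const (open) Matrix.vec

subsection \<open>Surface measure of the unit sphere\<close>

abbreviation S2 :: "(real ^ 3) set" where
  "S2 \<equiv> sphere 0 1"

text \<open>
  The surface measure of a set \<open>A\<close> on the sphere is \<open>3\<close> times the volume of the cone
  \<open>{t x | x \<in> A, 0 < t \<le> 1}\<close>, the normalization that makes integration in polar coordinates
  read \<open>\<integral> f dx = \<integral> \<integral> f (r x) r\<^sup>2 d\<mu>(x) dr\<close>. The map \<open>sgn x = x / norm x\<close> is the radial
  projection; the origin is removed because \<open>sgn 0 = 0\<close> is not on the sphere.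
\<close>

definition surface_measure :: "(real ^ 3) measure" where
  "surface_measure = scale_measure 3
     (distr (restrict_space lborel (cball 0 1 - {0})) (restrict_space borel S2) sgn)"

lemma space_surface_measure [simp]: "space surface_measure = S2"
  by (simp add: surface_measure_def space_scale_measure space_restrict_space)

lemma emeasure_surface_measure:
  assumes "A \<in> sets (restrict_space borel S2)"
  shows "emeasure surface_measure A = 3 * emeasure lborel {x \<in> cball 0 1 - {0}. sgn x \<in> A}"
proof -
  have m: "sgn \<in> restrict_space lborel (cball (0::real^3) 1 - {0}) \<rightarrow>\<^sub>M restrict_space borel S2"
  proof (rule measurable_restrict_space2)
    show "sgn \<in> space (restrict_space lborel (cball (0::real^3) 1 - {0})) \<rightarrow> S2"
      by (auto simp: space_restrict_space norm_sgn)
    have "(\<lambda>x::real^3. x /\<^sub>R norm x) \<in> borel_measurable lborel"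
      by measurable
    then show "sgn \<in> borel_measurable (restrict_space lborel (cball (0::real^3) 1 - {0}))"
      by (simp add: sgn_div_norm[abs_def] measurable_restrict_space1)
  qed
  have "emeasure surface_measure A
      = 3 * emeasure (restrict_space lborel (cball (0::real^3) 1 - {0}))
          (sgn -` A \<inter> space (restrict_space lborel (cball (0::real^3) 1 - {0})))"
    using assms m by (simp add: surface_measure_def emeasure_distr)
  also have "sgn -` A \<inter> space (restrict_space lborel (cball (0::real^3) 1 - {0}))
      = {x \<in> cball 0 1 - {0}. sgn x \<in> A}"
    by (auto simp: space_restrict_space)
  also have "emeasure (restrict_space lborel (cball (0::real^3) 1 - {0})) \<dots> = emeasure lborel \<dots>"
    by (rule emeasure_restrict_space) auto
  finally show ?thesis .
qed

lemma emeasure_surface_measure_S2: "emeasure surface_measure S2 = ennreal (4 * pi)"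
proof -
  have "emeasure surface_measure S2
      = 3 * emeasure lborel {x \<in> cball (0::real^3) 1 - {0}. sgn x \<in> S2}"
    by (rule emeasure_surface_measure) (metis sets.top space_restrict_space space_borel Int_UNIV_right)
  also have "{x \<in> cball (0::real^3) 1 - {0}. sgn x \<in> S2} = cball 0 1 - {0}"
    by (auto simp: norm_sgn)
  also have "emeasure lborel (cball (0::real^3) 1 - {0}) = emeasure lborel (cball (0::real^3) 1)"
    by (rule emeasure_Diff_null_set) auto
  also have "\<dots> = ennreal (4 / 3 * pi)"
    by (simp add: emeasure_cball unit_ball_vol_3)
  also have "3 * \<dots> = ennreal (4 * pi)"
    by (subst ennreal_numeral[symmetric], subst ennreal_mult[symmetric]) auto
  finally show ?thesis .
qed

subsection \<open>Spherical harmonics\<close>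

definition homogeneous_poly :: "nat \<Rightarrow> (real ^ 3 \<Rightarrow> complex) \<Rightarrow> bool" where
  "homogeneous_poly n p \<longleftrightarrow> (\<exists>c :: nat \<Rightarrow> nat \<Rightarrow> complex. \<forall>x.
     p x = (\<Sum>a\<le>n. \<Sum>b\<le>n - a. c a b * of_real ((x $ 1) ^ a * (x $ 2) ^ b * (x $ 3) ^ (n - a - b))))"

definition partial :: "3 \<Rightarrow> (real ^ 3 \<Rightarrow> complex) \<Rightarrow> real ^ 3 \<Rightarrow> complex" where
  "partial i f x = vector_derivative (\<lambda>t. f (x + t *\<^sub>R axis i 1)) (at 0)"

definition laplacian :: "(real ^ 3 \<Rightarrow> complex) \<Rightarrow> real ^ 3 \<Rightarrow> complex" where
  "laplacian f x = (\<Sum>i\<in>UNIV. partial i (partial i f) x)"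

text \<open>
  Functions on the sphere are represented by functions on the whole space; only the values on
  the sphere matter.
\<close>

definition spherical_harmonic :: "nat \<Rightarrow> (real ^ 3 \<Rightarrow> complex) \<Rightarrow> bool" where
  "spherical_harmonic n f \<longleftrightarrow>
     (\<exists>p. homogeneous_poly n p \<and> (\<forall>x. laplacian p x = 0) \<and> (\<forall>x\<in>S2. f x = p x))"

text \<open>
  A family \<open>Y n k\<close> (only \<open>-n \<le> k \<le> n\<close> is relevant) of spherical harmonics of degree \<open>n\<close> that is an
  orthonormal basis of \<open>L\<^sub>2(S2)\<close>: orthonormal, with finite linear combinations dense.
\<close>

definition spherical_harmonics_onb :: "(nat \<Rightarrow> int \<Rightarrow> real ^ 3 \<Rightarrow> complex) \<Rightarrow> bool" where
  "spherical_harmonics_onb Y \<longleftrightarrow>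
     (\<forall>n. \<forall>k\<in>{- int n..int n}. spherical_harmonic n (Y n k)) \<and>
     (\<forall>n n'. \<forall>k\<in>{- int n..int n}. \<forall>k'\<in>{- int n'..int n'}.
        (LINT x|surface_measure. Y n k x * cnj (Y n' k' x))
          = (if n = n' \<and> k = k' then 1 else 0)) \<and>
     (\<forall>f \<in> borel_measurable surface_measure. integrable surface_measure (\<lambda>x. (norm (f x))\<^sup>2) \<longrightarrow>
        (\<forall>\<epsilon>>0. \<exists>M c. (LINT x|surface_measure.
            (norm (f x - (\<Sum>n\<le>M. \<Sum>k\<in>{- int n..int n}. c n k * Y n k x)))\<^sup>2) < \<epsilon>))"

definition exact_quadrature :: "(real ^ 3) set \<Rightarrow> (real ^ 3 \<Rightarrow> real) \<Rightarrow> nat \<Rightarrow> bool" where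
  "exact_quadrature X w d \<longleftrightarrow> (\<forall>n\<le>d. \<forall>f. spherical_harmonic n f \<longrightarrow>
     (\<Sum>x\<in>X. of_real (w x) * f x) = (LINT x|surface_measure. f x))"

subsection \<open>Matrices\<close>

text \<open>
  Rows are indexed by the positions in a list \<open>xs\<close> enumerating the node set, columns by the
  positions in the list of all \<open>(n, k)\<close> with \<open>n \<le> N\<close> and \<open>-n \<le> k \<le> n\<close>.
\<close>

definition freq_indices :: "nat \<Rightarrow> (nat \<times> int) list" where
  "freq_indices N = concat (map (\<lambda>n. map (\<lambda>k. (n, k)) [- int n..int n]) [0..<Suc N])"

definition fourier_matrix ::
  "(nat \<Rightarrow> int \<Rightarrow> real ^ 3 \<Rightarrow> complex) \<Rightarrow> nat \<Rightarrow> (real ^ 3) list \<Rightarrow> complex mat" where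
  "fourier_matrix Y N xs = Matrix.mat (length xs) (length (freq_indices N))
     (\<lambda>(i, j). case freq_indices N ! j of (n, k) \<Rightarrow> Y n k (xs ! i))"

definition weight_matrix :: "(real ^ 3 \<Rightarrow> real) \<Rightarrow> (real ^ 3) list \<Rightarrow> complex mat" where
  "weight_matrix w xs = mat_diag (length xs) (\<lambda>i. of_real (w (xs ! i)))"

definition freq_weight_matrix :: "(nat \<Rightarrow> real) \<Rightarrow> nat \<Rightarrow> complex mat" where
  "freq_weight_matrix wh N =
     mat_diag (length (freq_indices N)) (\<lambda>j. of_real (wh (fst (freq_indices N ! j))))"

definition normal_matrix ::
  "(nat \<Rightarrow> int \<Rightarrow> real ^ 3 \<Rightarrow> complex) \<Rightarrow> nat \<Rightarrow> real \<Rightarrow> (real ^ 3 \<Rightarrow> real) \<Rightarrow> (nat \<Rightarrow> real)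
     \<Rightarrow> (real ^ 3) list \<Rightarrow> complex mat" where
  "normal_matrix Y N lam w wh xs = (let F = fourier_matrix Y N xs in
     mat_adjoint F * weight_matrix w xs * F + of_real lam \<cdot>\<^sub>m freq_weight_matrix wh N)"

text \<open>\<open>mat_inverse\<close> returns \<open>None\<close> on a singular matrix; \<open>hat_matrix\<close> is meaningful only if
  \<open>normal_matrix\<close> is invertible.\<close>

definition hat_matrix ::
  "(nat \<Rightarrow> int \<Rightarrow> real ^ 3 \<Rightarrow> complex) \<Rightarrow> nat \<Rightarrow> real \<Rightarrow> (real ^ 3 \<Rightarrow> real) \<Rightarrow> (nat \<Rightarrow> real)
     \<Rightarrow> (real ^ 3) list \<Rightarrow> complex mat" where
  "hat_matrix Y N lam w wh xs = (let F = fourier_matrix Y N xs in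
     F * the (mat_inverse (normal_matrix Y N lam w wh xs)) * mat_adjoint F * weight_matrix w xs)"

end

theory Submission
  imports Defs
begin

text \<open>
  Exactness of degree \<open>2 * N\<close> turns the quadrature sums of products of spherical harmonics of degree
  at most \<open>N\<close> into their inner products in \<open>L\<^sub>2(S2)\<close>, so the columns of the Fourier matrix
  are orthonormal for the inner product with weights \<open>w\<close> (\<open>discrete_orthonormality\<close>). The normal matrix is therefore diagonal with
  entries \<open>1 + lam * wh n > 0\<close>, and the diagonal entry of the hat matrix at a node \<open>x\<close> is
  \<open>w x\<close> times the sum over \<open>n \<le> N\<close> of \<open>1 / (1 + lam * wh n)\<close> times the sum over \<open>k\<close> of the
  squared moduli of \<open>Y n k x\<close>. The addition theorem (\<open>addition_theorem_diagonal\<close>) evaluates the inner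
  sum as \<open>(2 * n + 1) / (4 * pi)\<close>.

  Both ingredients rest on a count of dimensions. Since the third coordinate satisfies a
  quadratic equation on the sphere, the polynomials of degree at most \<open>d\<close>, restricted to the sphere,
  are spanned by \<open>(d + 1)\<^sup>2\<close> monomials (\<open>card_reduced_exponents\<close>). This is also the number of
  orthonormal functions \<open>Y n k\<close> with \<open>n \<le> d\<close>, all of which are such polynomials; hence they form
  a basis of that space (\<open>sphere_poly_harmonic_expansion\<close>). For the first ingredient, the product
  of a harmonic and a conjugate harmonic, a polynomial of degree at most \<open>2 * N\<close>, is thereby a
  linear combination of harmonics for which the quadrature is exact. For the second, the space of
  polynomials of degree at most \<open>d\<close> is invariant under orthogonal maps, and so is the surface measure.
  Hence the sum of the squared moduli of all \<open>Y n k\<close> with \<open>n \<le> d\<close> is invariant as well, which makes it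
  constant on the sphere, with integral \<open>(d + 1)\<^sup>2\<close>. Consecutive differences in \<open>d\<close> isolate the degree \<open>n\<close>.
\<close>

section \<open>Polynomials restricted to the sphere\<close>

text \<open>
  Polynomial functions of total degree at most \<open>d\<close>, given by closure rules rather than by
  coefficients: stability under products, conjugation and linear substitutions, and continuity,
  then follow by rule induction.
\<close>

inductive poly_deg_le :: "nat \<Rightarrow> (real ^ 3 \<Rightarrow> complex) \<Rightarrow> bool" where
  const: "poly_deg_le d (\<lambda>_. c)"
| add: "poly_deg_le d f \<Longrightarrow> poly_deg_le d g \<Longrightarrow> poly_deg_le d (\<lambda>x. f x + g x)"
| coord: "poly_deg_le d f \<Longrightarrow> poly_deg_le (Suc d) (\<lambda>x. of_real (x $ i) * f x)"

lemma poly_deg_le_Suc: "poly_deg_le d f \<Longrightarrow> poly_deg_le (Suc d) f"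
  by (induction rule: poly_deg_le.induct) (auto intro: poly_deg_le.intros)

lemma poly_deg_le_mono: "poly_deg_le d f \<Longrightarrow> d \<le> d' \<Longrightarrow> poly_deg_le d' f"
  by (rotate_tac 1, induction rule: dec_induct) (auto intro: poly_deg_le_Suc)

lemma poly_deg_le_scale:
  assumes "poly_deg_le d f" shows "poly_deg_le d (\<lambda>x. c * f x)"
  using assms
proof (induction rule: poly_deg_le.induct)
  case (coord d f i)
  from poly_deg_le.coord[OF coord.IH, of i] show ?case by (simp add: mult.left_commute)
qed (auto intro: poly_deg_le.intros simp: distrib_left)

lemma poly_deg_le_mult:
  assumes "poly_deg_le d f" "poly_deg_le e g"
  shows "poly_deg_le (d + e) (\<lambda>x. f x * g x)"
  using assms(1)
proof (induction rule: poly_deg_le.induct)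
  case (const d c)
  show ?case using poly_deg_le_scale[OF assms(2)] by (rule poly_deg_le_mono) simp
next
  case (add d f g)
  then show ?case using poly_deg_le.add by (simp add: distrib_right)
next
  case (coord d f i)
  from poly_deg_le.coord[OF coord.IH, of i] show ?case by (simp add: mult.assoc)
qed

lemma poly_deg_le_sum:
  assumes "\<And>i. i \<in> A \<Longrightarrow> poly_deg_le d (f i)"
  shows "poly_deg_le d (\<lambda>x. \<Sum>i\<in>A. f i x)"
  using assms
  by (induction A rule: infinite_finite_induct) (auto intro: poly_deg_le.intros)

lemma poly_deg_le_cnj: "poly_deg_le d f \<Longrightarrow> poly_deg_le d (\<lambda>x. cnj (f x))"
  by (induction rule: poly_deg_le.induct) (auto intro: poly_deg_le.intros)

lemma continuous_on_poly_deg_le: "poly_deg_le d f \<Longrightarrow> continuous_on A f"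
  by (induction rule: poly_deg_le.induct) (auto intro!: continuous_intros)

lemma poly_deg_le_coord_power: "poly_deg_le n (\<lambda>x. of_real (x $ i) ^ n)"
  by (induction n) (auto intro: poly_deg_le.intros)

text \<open>
  A coordinate of \<open>T x\<close> is a linear combination of the coordinates of \<open>x\<close>.
\<close>

lemma poly_deg_le_linear_comp:
  assumes "poly_deg_le d f" "linear (T :: real ^ 3 \<Rightarrow> real ^ 3)"
  shows "poly_deg_le d (\<lambda>x. f (T x))"
  using assms(1)
proof (induction rule: poly_deg_le.induct)
  case (coord d f i)
  have T: "T x = matrix T *v x" for x
    using assms(2) by (simp add: matrix_works)
  have eq: "(\<lambda>x. of_real (T x $ i) * f (T x))
      = (\<lambda>x. \<Sum>j\<in>UNIV. of_real (matrix T $ i $ j) * (of_real (x $ j) * f (T x)))"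
    by (subst T) (simp add: matrix_vector_mult_def sum_distrib_right mult.assoc)
  show ?case
    unfolding eq by (intro poly_deg_le_sum poly_deg_le_scale poly_deg_le.coord coord.IH)
qed (auto intro: poly_deg_le.intros)

lemma homogeneous_poly_imp_poly_deg_le:
  assumes "homogeneous_poly n p" shows "poly_deg_le n p"
proof -
  obtain c where c: "p = (\<lambda>x. \<Sum>a\<le>n. \<Sum>b\<le>n - a.
      c a b * of_real ((x $ 1) ^ a * (x $ 2) ^ b * (x $ 3) ^ (n - a - b)))"
    using assms by (auto simp: homogeneous_poly_def)
  have "poly_deg_le n (\<lambda>x. of_real ((x $ 1) ^ a * (x $ 2) ^ b * (x $ 3) ^ (n - a - b)))"
    if "a \<le> n" "b \<le> n - a" for a b
    using poly_deg_le_mult[OF poly_deg_le_mult[OF poly_deg_le_coord_power[of a 1]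
        poly_deg_le_coord_power[of b 2]] poly_deg_le_coord_power[of "n - a - b" 3]] that
    by simp
  then show ?thesis
    unfolding c by (intro poly_deg_le_sum poly_deg_le_scale) auto
qed

fun monomial3 :: "nat \<times> nat \<times> nat \<Rightarrow> real ^ 3 \<Rightarrow> complex" where
  "monomial3 (a, b, e) x = of_real (x $ 1) ^ a * of_real (x $ 2) ^ b * of_real (x $ 3) ^ e"

text \<open>
  On the sphere the square of the third coordinate is a polynomial in the other two, so the
  monomials with third exponent at most \<open>1\<close> span all polynomial functions. What matters is that
  there are only \<open>(d + 1)\<^sup>2\<close> of them in degree at most \<open>d\<close>: as many as there are
  frequencies \<open>(n, k)\<close> with \<open>n \<le> d\<close>.
\<close>

definition reduced_exponents :: "nat \<Rightarrow> (nat \<times> nat \<times> nat) set" where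
  "reduced_exponents d = {(a, b, e). e \<le> 1 \<and> a + b + e \<le> d}"

lemma finite_reduced_exponents [simp]: "finite (reduced_exponents d)"
  by (rule finite_subset[of _ "{..d} \<times> {..d} \<times> {..1}"]) (auto simp: reduced_exponents_def)

text \<open>
  Raising the degree bound from \<open>d\<close> to \<open>d + 1\<close> adds \<open>d + 2\<close> monomials in the first two coordinates
  and \<open>d + 1\<close> monomials containing the third one once.
\<close>

lemma card_reduced_exponents: "card (reduced_exponents d) = (Suc d)\<^sup>2"
proof (induction d)
  case 0
  have "reduced_exponents 0 = {(0, 0, 0)}" by (auto simp: reduced_exponents_def)
  then show ?case by simp
next
  case (Suc d)
  let ?A = "(\<lambda>a. (a, Suc d - a, 0 :: nat)) ` {..Suc d}"
  let ?B = "(\<lambda>a. (a, d - a, 1 :: nat)) ` {..d}"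
  have eq: "reduced_exponents (Suc d) = reduced_exponents d \<union> (?A \<union> ?B)"
  proof (rule Set.set_eqI)
    fix m :: "nat \<times> nat \<times> nat"
    obtain a b e where m: "m = (a, b, e)" by (cases m)
    have A: "m \<in> ?A \<longleftrightarrow> e = 0 \<and> a + b = Suc d"
      by (auto simp: m image_iff)
    have B: "m \<in> ?B \<longleftrightarrow> e = 1 \<and> a + b = d"
      by (auto simp: m image_iff)
    show "m \<in> reduced_exponents (Suc d) \<longleftrightarrow> m \<in> reduced_exponents d \<union> (?A \<union> ?B)"
      unfolding Un_iff A B by (simp add: m reduced_exponents_def) linarith
  qed
  have "card ?A = d + 2" "card ?B = d + 1"
    by (subst card_image; auto simp: inj_on_def)+
  moreover have "card (?A \<union> ?B) = card ?A + card ?B"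
    by (intro card_Un_disjoint) auto
  moreover have "card (reduced_exponents (Suc d)) = card (reduced_exponents d) + card (?A \<union> ?B)"
    unfolding eq by (intro card_Un_disjoint finite_reduced_exponents) (auto simp: reduced_exponents_def)
  ultimately show ?case using Suc by (simp add: power2_eq_square)
qed

text \<open>
  Only the values on the sphere are constrained; this is what allows the reduction of the third
  exponent.
\<close>

definition reduced_expansion :: "nat \<Rightarrow> (real ^ 3 \<Rightarrow> complex) \<Rightarrow> bool" where
  "reduced_expansion d f \<longleftrightarrow>
     (\<exists>c. \<forall>x\<in>S2. f x = (\<Sum>m\<in>reduced_exponents d. c m * monomial3 m x))"

lemma reduced_expansion_cong:
  "(\<And>x. x \<in> S2 \<Longrightarrow> f x = g x) \<Longrightarrow> reduced_expansion d f = reduced_expansion d g"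
  by (simp add: reduced_expansion_def)

lemma reduced_expansion_monomial:
  assumes "m \<in> reduced_exponents d" shows "reduced_expansion d (monomial3 m)"
  unfolding reduced_expansion_def
proof (intro exI ballI)
  fix x
  have "(\<Sum>m'\<in>reduced_exponents d. of_bool (m' = m) * monomial3 m' x)
      = (\<Sum>m'\<in>reduced_exponents d. if m' = m then monomial3 m' x else 0)"
    by (intro sum.cong) auto
  then show "monomial3 m x = (\<Sum>m'\<in>reduced_exponents d. of_bool (m' = m) * monomial3 m' x)"
    using assms by simp
qed

lemma reduced_expansion_add:
  assumes "reduced_expansion d f" "reduced_expansion d g"
  shows "reduced_expansion d (\<lambda>x. f x + g x)"
proof -
  obtain c c' where "\<forall>x\<in>S2. f x = (\<Sum>m\<in>reduced_exponents d. c m * monomial3 m x)"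
    "\<forall>x\<in>S2. g x = (\<Sum>m\<in>reduced_exponents d. c' m * monomial3 m x)"
    using assms by (auto simp: reduced_expansion_def)
  then show ?thesis
    unfolding reduced_expansion_def
    by (intro exI[of _ "\<lambda>m. c m + c' m"]) (simp add: distrib_right sum.distrib)
qed

lemma reduced_expansion_scale:
  assumes "reduced_expansion d f" shows "reduced_expansion d (\<lambda>x. k * f x)"
proof -
  obtain c where "\<forall>x\<in>S2. f x = (\<Sum>m\<in>reduced_exponents d. c m * monomial3 m x)"
    using assms by (auto simp: reduced_expansion_def)
  then show ?thesis
    unfolding reduced_expansion_def
    by (intro exI[of _ "\<lambda>m. k * c m"]) (simp add: sum_distrib_left mult.assoc)
qed

lemma reduced_expansion_const: "reduced_expansion d (\<lambda>_. k)"
proof -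
  have "reduced_expansion d (\<lambda>x. k * monomial3 (0, 0, 0) x)"
    by (intro reduced_expansion_scale reduced_expansion_monomial) (simp add: reduced_exponents_def)
  then show ?thesis by simp
qed

lemma reduced_expansion_sum:
  assumes "\<And>i. i \<in> A \<Longrightarrow> reduced_expansion d (f i)"
  shows "reduced_expansion d (\<lambda>x. \<Sum>i\<in>A. f i x)"
  using assms
  by (induction A rule: infinite_finite_induct)
    (auto intro: reduced_expansion_add reduced_expansion_const)

lemma S2_third_coord_square:
  assumes "x \<in> S2" shows "(x $ 3)\<^sup>2 = 1 - (x $ 1)\<^sup>2 - (x $ 2)\<^sup>2"
  using assms by (simp add: norm_eq_1 inner_vec_def sum_3 power2_eq_square)

text \<open>
  The one interesting case is the third coordinate times a monomial that already contains it; the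
  equation of the sphere then removes the square.
\<close>

lemma reduced_expansion_coord_monomial:
  assumes "m \<in> reduced_exponents d"
  shows "reduced_expansion (Suc d) (\<lambda>x. of_real (x $ i) * monomial3 m x)"
proof -
  obtain a b e where m: "m = (a, b, e)" by (cases m)
  have e: "e \<le> 1" "a + b + e \<le> d" using assms by (auto simp: m reduced_exponents_def)
  have mon: "reduced_expansion (Suc d) (monomial3 (a', b', e'))" if "e' \<le> 1" "a' + b' + e' \<le> Suc d" for a' b' e'
    by (rule reduced_expansion_monomial) (use that in \<open>auto simp: reduced_exponents_def\<close>)
  consider "i = 1" | "i = 2" | "i = 3" "e = 0" | "i = 3" "e = 1"
    using exhaust_3[of i] e(1) by linarith
  then show ?thesis
  proof cases
    case 1
    have "reduced_expansion (Suc d) (monomial3 (Suc a, b, e))" using e by (intro mon) auto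
    then show ?thesis using 1 by (subst reduced_expansion_cong) (auto simp: m mult_ac)
  next
    case 2
    have "reduced_expansion (Suc d) (monomial3 (a, Suc b, e))" using e by (intro mon) auto
    then show ?thesis using 2 by (subst reduced_expansion_cong) (auto simp: m mult_ac)
  next
    case 3
    have "reduced_expansion (Suc d) (monomial3 (a, b, 1))" using 3 e by (intro mon) auto
    then show ?thesis using 3 by (subst reduced_expansion_cong) (auto simp: m mult_ac)
  next
    case 4
    have "reduced_expansion (Suc d) (\<lambda>x. monomial3 (a, b, 0) x
        + ((-1) * monomial3 (a + 2, b, 0) x + (-1) * monomial3 (a, b + 2, 0) x))"
      using 4 e by (intro reduced_expansion_add reduced_expansion_scale mon) auto
    moreover have "of_real (x $ i) * monomial3 m x = monomial3 (a, b, 0) x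
        + ((-1) * monomial3 (a + 2, b, 0) x + (-1) * monomial3 (a, b + 2, 0) x)" if "x \<in> S2" for x
    proof -
      have "of_real (x $ i) * monomial3 m x
          = of_real (x $ 1) ^ a * of_real (x $ 2) ^ b * complex_of_real ((x $ 3)\<^sup>2)"
        by (simp add: m 4 power2_eq_square mult_ac)
      also have "\<dots> = of_real (x $ 1) ^ a * of_real (x $ 2) ^ b
          * complex_of_real (1 - (x $ 1)\<^sup>2 - (x $ 2)\<^sup>2)"
        using S2_third_coord_square[OF that] by simp
      finally show ?thesis by (simp add: algebra_simps power2_eq_square)
    qed
    ultimately show ?thesis by (subst reduced_expansion_cong) auto
  qed
qed

lemma poly_deg_le_imp_reduced_expansion:
  "poly_deg_le d f \<Longrightarrow> reduced_expansion d f"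
proof (induction rule: poly_deg_le.induct)
  case (coord d f i)
  obtain c where c: "\<forall>x\<in>S2. f x = (\<Sum>m\<in>reduced_exponents d. c m * monomial3 m x)"
    using coord.IH by (auto simp: reduced_expansion_def)
  have "reduced_expansion (Suc d)
      (\<lambda>x. \<Sum>m\<in>reduced_exponents d. c m * (of_real (x $ i) * monomial3 m x))"
    by (intro reduced_expansion_sum reduced_expansion_scale reduced_expansion_coord_monomial)
  then show ?case
    by (subst reduced_expansion_cong) (auto simp: c sum_distrib_left mult_ac)
qed (auto intro: reduced_expansion_const reduced_expansion_add)

section \<open>Finite-dimensional linear algebra\<close>

lemma mat_inverse_obtain:
  fixes G :: "'a :: field mat"
  assumes "G \<in> carrier_mat D D" "Determinant.det G \<noteq> 0"
  obtains B where "B \<in> carrier_mat D D" "G * B = 1\<^sub>m D"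
proof (cases "mat_inverse G")
  case None
  then show ?thesis
    using mat_inverse(1)[OF assms(1)] det_non_zero_imp_unit[OF assms] by metis
next
  case (Some B)
  then show ?thesis using mat_inverse(2)[OF assms(1) Some] that by metis
qed

text \<open>
  A linearly independent family of \<open>D\<close> functions inside the span of \<open>D\<close> functions is a basis of that
  span: the coefficient matrix is invertible, since a kernel vector would be a linear relation.
\<close>

lemma invert_spanning_family:
  fixes b g :: "nat \<Rightarrow> 'a \<Rightarrow> complex"
  assumes g: "\<And>j x. j < D \<Longrightarrow> x \<in> S \<Longrightarrow> g j x = (\<Sum>i<D. c j i * b i x)"
    and indep: "\<And>v. (\<And>x. x \<in> S \<Longrightarrow> (\<Sum>j<D. v j * g j x) = 0) \<Longrightarrow> \<forall>j<D. v j = 0"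
  shows "\<exists>e. \<forall>i<D. \<forall>x\<in>S. b i x = (\<Sum>j<D. e i j * g j x)"
proof -
  define G where "G = Matrix.mat D D (\<lambda>(i, j). c j i)"
  have G: "G \<in> carrier_mat D D" by (simp add: G_def)
  have "Determinant.det G \<noteq> 0"
  proof
    assume "Determinant.det G = 0"
    then obtain v where v: "v \<in> carrier_vec D" "v \<noteq> 0\<^sub>v D" "G *\<^sub>v v = 0\<^sub>v D"
      using det_0_iff_vec_prod_zero[OF G] by blast
    have z: "(\<Sum>j<D. c j i * vec_index v j) = 0" if "i < D" for i
    proof -
      have "vec_index (G *\<^sub>v v) i = (\<Sum>j<D. c j i * vec_index v j)"
        using that v(1) by (simp add: G_def scalar_prod_def atLeast0LessThan)
      then show ?thesis using that v(3) by simp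
    qed
    have "(\<Sum>j<D. vec_index v j * g j x) = 0" if "x \<in> S" for x
    proof -
      have "(\<Sum>j<D. vec_index v j * g j x) = (\<Sum>j<D. \<Sum>i<D. vec_index v j * (c j i * b i x))"
        using that by (simp add: g sum_distrib_left)
      also have "\<dots> = (\<Sum>i<D. (\<Sum>j<D. c j i * vec_index v j) * b i x)"
        by (subst sum.swap) (simp add: sum_distrib_right mult.assoc mult.left_commute)
      finally show ?thesis using z by simp
    qed
    then have "\<forall>j<D. vec_index v j = 0" by (rule indep)
    then have "v = 0\<^sub>v D" using v(1) by (intro eq_vecI) auto
    with v(2) show False by simp
  qed
  then obtain B where B: "B \<in> carrier_mat D D" "G * B = 1\<^sub>m D"
    using mat_inverse_obtain[OF G] by blast
  have "b i x = (\<Sum>j<D. B $$ (j, i) * g j x)" if "i < D" "x \<in> S" for i x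
  proof -
    have d: "(\<Sum>j<D. c j k * B $$ (j, i)) = (if k = i then 1 else 0)" if "k < D" for k
    proof -
      have "(G * B) $$ (k, i) = (\<Sum>j<D. c j k * B $$ (j, i))"
        using that \<open>i < D\<close> B(1) by (simp add: G_def scalar_prod_def atLeast0LessThan)
      then show ?thesis using that \<open>i < D\<close> B(2) by simp
    qed
    have "(\<Sum>j<D. B $$ (j, i) * g j x) = (\<Sum>j<D. \<Sum>k<D. B $$ (j, i) * (c j k * b k x))"
      using that by (simp add: g sum_distrib_left)
    also have "\<dots> = (\<Sum>k<D. (\<Sum>j<D. c j k * B $$ (j, i)) * b k x)"
      by (subst sum.swap) (simp add: sum_distrib_right mult.assoc mult.left_commute)
    also have "\<dots> = (\<Sum>k<D. if k = i then b k x else 0)"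
      by (intro sum.cong) (auto simp: d)
    finally show ?thesis using that by simp
  qed
  then show ?thesis by (intro exI[of _ "\<lambda>i j. B $$ (j, i)"]) auto
qed

text \<open>
  Matrix form: \<open>U U\<^sup>H = 1\<close> implies \<open>U\<^sup>H U = 1\<close>.
\<close>

lemma orthonormal_rows_imp_orthonormal_columns:
  fixes u :: "nat \<Rightarrow> nat \<Rightarrow> complex"
  assumes rows: "\<And>i k. i < D \<Longrightarrow> k < D \<Longrightarrow> (\<Sum>j<D. u i j * cnj (u k j)) = of_bool (i = k)"
    and "j < D" "l < D"
  shows "(\<Sum>i<D. u i j * cnj (u i l)) = of_bool (j = l)"
proof -
  define U V where "U = Matrix.mat D D (\<lambda>(i, j). u i j)" and "V = Matrix.mat D D (\<lambda>(i, j). cnj (u j i))"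
  have carr: "U \<in> carrier_mat D D" "V \<in> carrier_mat D D" by (simp_all add: U_def V_def)
  have "U * V = 1\<^sub>m D"
    by (rule eq_matI)
      (auto simp: U_def V_def scalar_prod_def atLeast0LessThan rows)
  then have "V * U = 1\<^sub>m D"
    using carr mat_mult_left_right_inverse by blast
  then have "(V * U) $$ (l, j) = of_bool (j = l)"
    using assms(2,3) by auto
  moreover have "(V * U) $$ (l, j) = (\<Sum>i<D. u i j * cnj (u i l))"
    using assms(2,3) by (simp add: U_def V_def scalar_prod_def atLeast0LessThan mult.commute)
  ultimately show ?thesis by simp
qed

lemma mat_adjoint_eq_mat:
  "mat_adjoint (A :: complex mat) = Matrix.mat (dim_col A) (dim_row A) (\<lambda>(i, j). cnj (A $$ (j, i)))"
  by (rule eq_matI) (auto simp: mat_adjoint_def mat_of_rows_index)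

lemma mat_inverse_eqI:
  fixes A :: "'a :: field mat"
  assumes A: "A \<in> carrier_mat D D" and B: "B \<in> carrier_mat D D" and AB: "A * B = 1\<^sub>m D"
  shows "mat_inverse A = Some B"
proof (cases "mat_inverse A")
  case None
  have "B * A = 1\<^sub>m D" using mat_mult_left_right_inverse[OF A B AB] .
  then have "A \<in> Units (ring_mat TYPE('a) D ())"
    using A B AB by (auto simp: Units_def ring_mat_simps)
  with mat_inverse(1)[OF A None, of "()"] show ?thesis by contradiction
next
  case (Some C)
  then have C: "C * A = 1\<^sub>m D" "C \<in> carrier_mat D D" using mat_inverse(2)[OF A] by blast+
  have "C = C * (A * B)" using C AB by simp
  also have "\<dots> = (C * A) * B" using assoc_mult_mat[OF C(2) A B] by simp
  finally show ?thesis using B C Some by simp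
qed

section \<open>Orthogonal invariance of the surface measure\<close>

lemma sets_surface_measure: "sets surface_measure = sets (restrict_space borel S2)"
  by (simp add: surface_measure_def)

interpretation surface_measure: finite_measure surface_measure
  by standard (simp add: emeasure_surface_measure_S2)

lemma measure_surface_measure_S2: "measure surface_measure S2 = 4 * pi"
  by (simp add: measure_def emeasure_surface_measure_S2)

lemma measurable_surface_measure_restrict:
  "f \<in> borel_measurable borel \<Longrightarrow> f \<in> borel_measurable surface_measure"
  by (subst measurable_cong_sets[OF sets_surface_measure refl]) (rule measurable_restrict_space1)

lemma borel_sgn_vimage:
  assumes "A \<in> sets (restrict_space borel S2)"
  shows "{x \<in> cball (0 :: real ^ 3) 1 - {0}. sgn x \<in> A} \<in> sets borel"
proof -
  have "(\<lambda>x :: real ^ 3. x /\<^sub>R norm x) \<in> borel_measurable borel" by measurable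
  then have sgn: "sgn \<in> borel_measurable (borel :: (real ^ 3) measure)"
    by (simp add: sgn_div_norm[abs_def])
  have "A \<in> sets borel"
    using assms by (subst (asm) sets_restrict_space_iff) auto
  then have "sgn -` A \<inter> space borel \<in> sets (borel :: (real ^ 3) measure)"
    by (rule measurable_sets[OF sgn])
  then have "(cball 0 1 - {0}) \<inter> sgn -` A \<in> sets (borel :: (real ^ 3) measure)"
    by auto
  also have "(cball 0 1 - {0}) \<inter> sgn -` A = {x \<in> cball (0 :: real ^ 3) 1 - {0}. sgn x \<in> A}"
    by auto
  finally show ?thesis .
qed

lemma emeasure_lborel_orthogonal_image:
  fixes T :: "real ^ 3 \<Rightarrow> real ^ 3"
  assumes T: "orthogonal_transformation T"
    and D: "D \<in> sets borel" "bounded D" and TD: "T ` D \<in> sets borel"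
  shows "emeasure lborel (T ` D) = emeasure lborel D"
proof -
  have lm: "D \<in> lmeasurable"
    using D by (intro bounded_set_imp_lmeasurable) auto
  have "emeasure lborel (T ` D) = emeasure lebesgue (T ` D)"
    using TD by simp
  also have "\<dots> = ennreal (measure lebesgue (T ` D))"
    using measurable_orthogonal_image[OF T lm] by (intro emeasure_eq_measure2) auto
  also have "\<dots> = ennreal (measure lebesgue D)"
    by (simp only: measure_orthogonal_image[OF T lm])
  also have "\<dots> = emeasure lebesgue D"
    using lm by (intro emeasure_eq_measure2[symmetric]) auto
  also have "\<dots> = emeasure lborel D"
    using D by simp
  finally show ?thesis .
qed

lemma orthogonal_transformation_in_S2:
  "orthogonal_transformation T \<Longrightarrow> T x \<in> S2 \<longleftrightarrow> x \<in> S2"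
  by (simp add: orthogonal_transformation_norm)

lemma measurable_orthogonal_surface_measure:
  assumes T: "orthogonal_transformation T"
  shows "T \<in> measurable surface_measure surface_measure"
proof -
  have "T \<in> borel_measurable borel"
    using T by (intro borel_measurable_continuous_onI linear_continuous_on linear_conv_bounded_linear[THEN iffD1]
        orthogonal_transformation_linear)
  then have "T \<in> restrict_space borel S2 \<rightarrow>\<^sub>M restrict_space borel S2"
    using orthogonal_transformation_in_S2[OF T] by (intro measurable_restrict_space3) auto
  then show ?thesis
    by (simp add: measurable_cong_sets[OF sets_surface_measure sets_surface_measure])
qed

text \<open>
  The surface measure of a set is a multiple of the Lebesgue measure of the cone over it, and an
  orthogonal map takes the cone over a preimage onto the cone over the set.
\<close>

lemma distr_surface_measure_orthogonal:
  assumes T: "orthogonal_transformation T"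
  shows "distr surface_measure surface_measure T = surface_measure"
proof (rule measure_eqI)
  fix A assume "A \<in> sets (distr surface_measure surface_measure T)"
  then have A: "A \<in> sets surface_measure" by simp
  let ?B = "T -` A \<inter> S2"
  let ?cone = "\<lambda>A. {x \<in> cball (0 :: real ^ 3) 1 - {0}. sgn x \<in> A}"
  note meas = measurable_orthogonal_surface_measure[OF T]
  have B: "?B \<in> sets surface_measure"
    using measurable_sets[OF meas A] by simp
  have lin: "linear T" using T by (rule orthogonal_transformation_linear)
  have sgn: "sgn (T x) = T (sgn x)" for x
    by (simp add: sgn_div_norm orthogonal_transformation_norm[OF T] linear_cmul[OF lin])
  have cone: "?cone A = T ` ?cone ?B"
  proof (intro equalityI subsetI)
    fix y assume y: "y \<in> ?cone A"
    obtain x where x: "y = T x" using orthogonal_transformation_surj[OF T] by blast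
    have "norm x = norm y" by (simp add: x orthogonal_transformation_norm[OF T])
    then have "x \<in> ?cone ?B" using y by (auto simp: x sgn norm_sgn)
    then show "y \<in> T ` ?cone ?B" using x by blast
  next
    fix y assume "y \<in> T ` ?cone ?B"
    then obtain x where x: "y = T x" "x \<in> ?cone ?B" by blast
    have "norm y = norm x" by (simp add: x orthogonal_transformation_norm[OF T])
    moreover from this have "y \<noteq> 0" using x(2) by auto
    ultimately show "y \<in> ?cone A" using x by (auto simp: sgn)
  qed
  have borel: "?cone A \<in> sets borel" "?cone ?B \<in> sets borel"
    using A B by (simp_all only: sets_surface_measure borel_sgn_vimage)
  have "bounded (?cone ?B)"
    by (rule bounded_subset[OF bounded_cball[of 0 1]]) auto
  then have eq: "emeasure lborel (?cone A) = emeasure lborel (?cone ?B)"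
    using borel emeasure_lborel_orthogonal_image[OF T borel(2)] cone by metis
  have "emeasure (distr surface_measure surface_measure T) A = emeasure surface_measure ?B"
    using meas A by (simp add: emeasure_distr)
  also have "\<dots> = 3 * emeasure lborel (?cone ?B)"
    using B by (intro emeasure_surface_measure) (simp add: sets_surface_measure)
  also have "\<dots> = emeasure surface_measure A"
    using A unfolding eq[symmetric]
    by (intro emeasure_surface_measure[symmetric]) (simp add: sets_surface_measure)
  finally show "emeasure (distr surface_measure surface_measure T) A = emeasure surface_measure A" .
qed simp

section \<open>Integration of polynomials over the sphere\<close>

lemma integral_S2_cong:
  "(\<And>x. x \<in> S2 \<Longrightarrow> f x = g x) \<Longrightarrow> (LINT x|surface_measure. f x) = (LINT x|surface_measure. g x)"
  by (intro Bochner_Integration.integral_cong) auto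

text \<open>
  The functions of interest are given by arbitrary representatives off the sphere, so being a
  polynomial is required on the sphere only.
\<close>

definition sphere_poly :: "nat \<Rightarrow> (real ^ 3 \<Rightarrow> complex) \<Rightarrow> bool" where
  "sphere_poly d f \<longleftrightarrow> (\<exists>p. poly_deg_le d p \<and> (\<forall>x\<in>S2. f x = p x))"

lemma sphere_poly_mono: "sphere_poly d f \<Longrightarrow> d \<le> d' \<Longrightarrow> sphere_poly d' f"
  unfolding sphere_poly_def using poly_deg_le_mono by blast

lemma sphere_poly_mult:
  assumes "sphere_poly d f" "sphere_poly e g"
  shows "sphere_poly (d + e) (\<lambda>x. f x * g x)"
proof -
  obtain p q where "poly_deg_le d p" "poly_deg_le e q" "\<forall>x\<in>S2. f x = p x" "\<forall>x\<in>S2. g x = q x"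
    using assms by (auto simp: sphere_poly_def)
  then show ?thesis
    unfolding sphere_poly_def by (intro exI[of _ "\<lambda>x. p x * q x"]) (simp add: poly_deg_le_mult)
qed

lemma sphere_poly_cnj:
  assumes "sphere_poly d f" shows "sphere_poly d (\<lambda>x. cnj (f x))"
proof -
  obtain p where "poly_deg_le d p" "\<forall>x\<in>S2. f x = p x"
    using assms by (auto simp: sphere_poly_def)
  then show ?thesis
    unfolding sphere_poly_def by (intro exI[of _ "\<lambda>x. cnj (p x)"]) (simp add: poly_deg_le_cnj)
qed

lemma sphere_poly_orthogonal_comp:
  assumes "sphere_poly d f" "orthogonal_transformation T"
  shows "sphere_poly d (\<lambda>x. f (T x))"
proof -
  obtain p where "poly_deg_le d p" "\<forall>x\<in>S2. f x = p x"
    using assms by (auto simp: sphere_poly_def)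
  then show ?thesis
    using orthogonal_transformation_in_S2[OF assms(2)] orthogonal_transformation_linear[OF assms(2)]
    unfolding sphere_poly_def by (intro exI[of _ "\<lambda>x. p (T x)"]) (simp add: poly_deg_le_linear_comp)
qed

lemma integrable_sphere_poly:
  assumes "sphere_poly d f" shows "integrable surface_measure f"
proof -
  obtain p where p: "poly_deg_le d p" "\<forall>x\<in>S2. f x = p x"
    using assms by (auto simp: sphere_poly_def)
  have "compact (p ` S2)"
    by (intro compact_continuous_image continuous_on_poly_deg_le[OF p(1)] compact_sphere)
  then obtain B where "\<And>y. y \<in> p ` S2 \<Longrightarrow> norm y \<le> B"
    using compact_imp_bounded bounded_iff by metis
  moreover have "p \<in> borel_measurable surface_measure"
    by (intro measurable_surface_measure_restrict borel_measurable_continuous_onI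
        continuous_on_poly_deg_le[OF p(1)])
  ultimately have "integrable surface_measure p"
    by (intro surface_measure.integrable_const_bound[of _ B] AE_I2) auto
  then show ?thesis
    using p(2) by (subst Bochner_Integration.integrable_cong[of _ _ f p]) auto
qed

lemma integral_orthogonal_comp:
  assumes "sphere_poly d f" "orthogonal_transformation T"
  shows "(LINT x|surface_measure. f (T x)) = (LINT x|surface_measure. f x)"
  using integral_distr[OF measurable_orthogonal_surface_measure[OF assms(2)]
      borel_measurable_integrable[OF integrable_sphere_poly[OF assms(1)]]]
  by (simp add: distr_surface_measure_orthogonal[OF assms(2)])

lemma spherical_harmonic_imp_sphere_poly: "spherical_harmonic n f \<Longrightarrow> sphere_poly n f"
  unfolding spherical_harmonic_def sphere_poly_def using homogeneous_poly_imp_poly_deg_le by blast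

section \<open>Enumeration of the frequencies\<close>

lemma set_freq_indices: "set (freq_indices d) = Sigma {..d} (\<lambda>n. {- int n..int n})"
proof -
  have "set (freq_indices d) = (\<Union>n\<in>{0..<Suc d}. Pair n ` {- int n..int n})"
    by (simp only: freq_indices_def set_concat set_map set_upt set_upto image_image)
  then show ?thesis by (auto simp: less_Suc_eq_le)
qed

lemma freq_indices_Suc: "freq_indices (Suc d)
    = freq_indices d @ map (\<lambda>k. (Suc d, k)) [- int (Suc d)..int (Suc d)]"
  by (simp add: freq_indices_def)

lemma distinct_freq_indices: "distinct (freq_indices d)"
proof (induction d)
  case 0
  show ?case by (simp add: freq_indices_def distinct_map inj_on_def)
next
  case (Suc d)
  then show ?case
    unfolding freq_indices_Suc by (auto simp: distinct_map inj_on_def set_freq_indices)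
qed

lemma length_freq_indices: "length (freq_indices d) = (Suc d)\<^sup>2"
proof (induction d)
  case 0
  show ?case by (simp add: freq_indices_def)
next
  case (Suc d)
  then show ?case
    unfolding freq_indices_Suc by (simp add: power2_eq_square)
qed

lemma sum_freq_indices:
  "(\<Sum>j<length (freq_indices d). h (freq_indices d ! j)) = (\<Sum>n\<le>d. \<Sum>k=- int n..int n. h (n, k))"
proof -
  have "(\<Sum>j<length (freq_indices d). h (freq_indices d ! j)) = sum h (set (freq_indices d))"
    by (rule sum.reindex_bij_betw[OF bij_betw_nth]) (auto simp: distinct_freq_indices)
  also have "\<dots> = (\<Sum>n\<le>d. \<Sum>k=- int n..int n. h (n, k))"
    by (simp add: set_freq_indices sum.Sigma)
  finally show ?thesis .
qed

section \<open>Spherical harmonics span the polynomials\<close>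

locale spherical_harmonics_basis =
  fixes Y :: "nat \<Rightarrow> int \<Rightarrow> real ^ 3 \<Rightarrow> complex"
  assumes onb: "spherical_harmonics_onb Y"
begin

text \<open>
  The basis functions numbered as the columns of the Fourier matrix, so that they can be fed into
  matrix arguments.
\<close>

definition harmonic :: "nat \<Rightarrow> nat \<Rightarrow> real ^ 3 \<Rightarrow> complex" where
  "harmonic d j = (case freq_indices d ! j of (n, k) \<Rightarrow> Y n k)"

lemma spherical_harmonic_harmonic:
  assumes "j < length (freq_indices d)"
  obtains n where "n \<le> d" "spherical_harmonic n (harmonic d j)"
proof -
  obtain n k where nk: "freq_indices d ! j = (n, k)" by (cases "freq_indices d ! j")
  then have "(n, k) \<in> set (freq_indices d)" using assms nth_mem by metis
  then have "n \<le> d" "k \<in> {- int n..int n}" by (auto simp: set_freq_indices)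
  then show ?thesis
    using onb nk by (intro that[of n]) (auto simp: spherical_harmonics_onb_def harmonic_def)
qed

lemma sphere_poly_harmonic: "j < length (freq_indices d) \<Longrightarrow> sphere_poly d (harmonic d j)"
  using spherical_harmonic_harmonic spherical_harmonic_imp_sphere_poly sphere_poly_mono by metis

lemma harmonic_orthonormal:
  assumes "i < length (freq_indices d)" "j < length (freq_indices d)"
  shows "(LINT x|surface_measure. harmonic d i x * cnj (harmonic d j x)) = of_bool (i = j)"
proof -
  obtain n k n' k' where nk: "freq_indices d ! i = (n, k)" "freq_indices d ! j = (n', k')"
    by (cases "freq_indices d ! i", cases "freq_indices d ! j")
  have "(n, k) \<in> set (freq_indices d)" "(n', k') \<in> set (freq_indices d)"
    using assms nk nth_mem by metis+
  then have "k \<in> {- int n..int n}" "k' \<in> {- int n'..int n'}" by (auto simp: set_freq_indices)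
  then have "(LINT x|surface_measure. harmonic d i x * cnj (harmonic d j x))
      = (if n = n' \<and> k = k' then 1 else 0)"
    using onb nk by (auto simp: spherical_harmonics_onb_def harmonic_def)
  moreover have "n = n' \<and> k = k' \<longleftrightarrow> i = j"
    using nth_eq_iff_index_eq[OF distinct_freq_indices assms] nk by simp
  ultimately show ?thesis by simp
qed

lemma integrable_harmonic_mult_cnj:
  assumes "i < length (freq_indices d)" "j < length (freq_indices d)"
  shows "integrable surface_measure (\<lambda>x. harmonic d i x * cnj (harmonic d j x))"
  using assms integrable_sphere_poly sphere_poly_mult sphere_poly_cnj sphere_poly_harmonic by blast

lemma integral_harmonic_combinations:
  assumes f: "\<And>x. x \<in> S2 \<Longrightarrow> f x = (\<Sum>j<length (freq_indices d). u j * harmonic d j x)"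
    and g: "\<And>x. x \<in> S2 \<Longrightarrow> g x = (\<Sum>j<length (freq_indices d). v j * harmonic d j x)"
  shows "(LINT x|surface_measure. f x * cnj (g x)) = (\<Sum>j<length (freq_indices d). u j * cnj (v j))"
proof -
  let ?L = "length (freq_indices d)"
  have "(LINT x|surface_measure. f x * cnj (g x))
      = (LINT x|surface_measure. (\<Sum>i<?L. \<Sum>j<?L. u i * cnj (v j) * (harmonic d i x * cnj (harmonic d j x))))"
    by (intro integral_S2_cong) (simp add: f g sum_product mult_ac)
  also have "\<dots> = (\<Sum>i<?L. LINT x|surface_measure. (\<Sum>j<?L. u i * cnj (v j) * (harmonic d i x * cnj (harmonic d j x))))"
    by (intro Bochner_Integration.integral_sum Bochner_Integration.integrable_sum
        integrable_mult_right integrable_harmonic_mult_cnj) auto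
  also have "\<dots> = (\<Sum>i<?L. \<Sum>j<?L. LINT x|surface_measure. u i * cnj (v j) * (harmonic d i x * cnj (harmonic d j x)))"
    by (intro sum.cong refl Bochner_Integration.integral_sum
        integrable_mult_right integrable_harmonic_mult_cnj) auto
  also have "\<dots> = (\<Sum>i<?L. \<Sum>j<?L. u i * cnj (v j) * of_bool (i = j))"
    by (intro sum.cong refl) (simp only: integral_mult_right_zero harmonic_orthonormal lessThan_iff)
  also have "\<dots> = (\<Sum>i<?L. \<Sum>j<?L. if j = i then u i * cnj (v j) else 0)"
    by (intro sum.cong) auto
  finally show ?thesis by simp
qed

text \<open>
  Orthonormality makes the \<open>(d + 1)\<^sup>2\<close> harmonics of degree at most \<open>d\<close> linearly independent,
  and they lie in the span of \<open>(d + 1)\<^sup>2\<close> reduced monomials. Hence both families span the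
  same space, which contains every polynomial of degree at most \<open>d\<close>.
\<close>

lemma sphere_poly_harmonic_expansion:
  assumes "sphere_poly d f"
  shows "\<exists>e. \<forall>x\<in>S2. f x = (\<Sum>j<length (freq_indices d). e j * harmonic d j x)"
proof -
  define D where "D = length (freq_indices d)"
  obtain ms where ms: "distinct ms" "set ms = reduced_exponents d"
    using finite_distinct_list[OF finite_reduced_exponents] by blast
  have len: "length ms = D"
    using distinct_card[OF ms(1)] by (simp add: ms card_reduced_exponents D_def length_freq_indices)
  have expand: "\<exists>c. \<forall>x\<in>S2. h x = (\<Sum>i<D. c i * monomial3 (ms ! i) x)" if h: "sphere_poly d h" for h
  proof -
    obtain p where p: "poly_deg_le d p" "\<forall>x\<in>S2. h x = p x"
      using h by (auto simp: sphere_poly_def)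
    obtain c where c: "\<forall>x\<in>S2. p x = (\<Sum>m\<in>reduced_exponents d. c m * monomial3 m x)"
      using poly_deg_le_imp_reduced_expansion[OF p(1)] by (auto simp: reduced_expansion_def)
    have "(\<Sum>m\<in>reduced_exponents d. c m * monomial3 m x)
        = (\<Sum>i<D. c (ms ! i) * monomial3 (ms ! i) x)" for x
      by (rule sum.reindex_bij_betw[OF bij_betw_nth, symmetric]) (auto simp: ms len)
    then show ?thesis using p c by (intro exI[of _ "\<lambda>i. c (ms ! i)"]) simp
  qed
  have "\<forall>j. \<exists>c. j < D \<longrightarrow> (\<forall>x\<in>S2. harmonic d j x = (\<Sum>i<D. c i * monomial3 (ms ! i) x))"
    using expand[OF sphere_poly_harmonic] by (simp add: D_def)
  from choice[OF this] obtain c where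
    c: "\<And>j x. j < D \<Longrightarrow> x \<in> S2 \<Longrightarrow> harmonic d j x = (\<Sum>i<D. c j i * monomial3 (ms ! i) x)"
    by blast
  \<comment> \<open>Inner products with the basis functions read off the coefficients.\<close>
  have indep: "\<forall>j<D. v j = 0" if v: "\<And>x. x \<in> S2 \<Longrightarrow> (\<Sum>j<D. v j * harmonic d j x) = 0" for v
  proof (intro allI impI)
    fix k assume k: "k < D"
    have "0 = (LINT x|surface_measure. 0 * cnj (harmonic d k x))" by simp
    also have "\<dots> = (\<Sum>j<D. v j * cnj (of_bool (j = k)))"
      unfolding D_def
    proof (rule integral_harmonic_combinations)
      show "0 = (\<Sum>j<length (freq_indices d). v j * harmonic d j x)" if "x \<in> S2" for x
        using v[OF that] by (simp add: D_def)
      show "harmonic d k x = (\<Sum>j<length (freq_indices d). of_bool (j = k) * harmonic d j x)" for x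
      proof -
        have "(\<Sum>j<D. of_bool (j = k) * harmonic d j x) = (\<Sum>j<D. if j = k then harmonic d j x else 0)"
          by (intro sum.cong) auto
        then show ?thesis using k by (simp add: D_def)
      qed
    qed
    also have "\<dots> = v k" using k by (simp add: of_bool_def if_distrib cong: if_cong)
    finally show "v k = 0" by simp
  qed
  obtain e where e: "\<forall>i<D. \<forall>x\<in>S2. monomial3 (ms ! i) x = (\<Sum>j<D. e i j * harmonic d j x)"
    using invert_spanning_family[of D S2 "harmonic d" c "\<lambda>i. monomial3 (ms ! i)"] c indep by blast
  obtain c' where c': "\<forall>x\<in>S2. f x = (\<Sum>i<D. c' i * monomial3 (ms ! i) x)"
    using expand[OF assms] by blast
  have "f x = (\<Sum>j<D. (\<Sum>i<D. c' i * e i j) * harmonic d j x)" if "x \<in> S2" for x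
  proof -
    have "f x = (\<Sum>i<D. \<Sum>j<D. c' i * e i j * harmonic d j x)"
      using that c' e by (simp add: sum_distrib_left mult.assoc)
    also have "\<dots> = (\<Sum>j<D. (\<Sum>i<D. c' i * e i j) * harmonic d j x)"
      by (subst sum.swap) (simp add: sum_distrib_right)
    finally show ?thesis .
  qed
  then show ?thesis
    unfolding D_def by (intro exI[of _ "\<lambda>j. \<Sum>i<D. c' i * e i j"] ballI) (simp only: D_def)
qed

text \<open>
  Exactness extends from the harmonics to their span. This is what makes the quadrature applicable
  to products of harmonics, which are polynomials but in general not harmonics.
\<close>

lemma exact_quadrature_sphere_poly:
  assumes "exact_quadrature X w d" "X \<subseteq> S2" "sphere_poly d f"
  shows "(\<Sum>x\<in>X. of_real (w x) * f x) = (LINT x|surface_measure. f x)"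
proof -
  let ?L = "length (freq_indices d)"
  obtain e where e: "\<forall>x\<in>S2. f x = (\<Sum>j<?L. e j * harmonic d j x)"
    using sphere_poly_harmonic_expansion[OF assms(3)] by blast
  have q: "(\<Sum>x\<in>X. of_real (w x) * harmonic d j x) = (LINT x|surface_measure. harmonic d j x)"
    if j: "j < ?L" for j
  proof -
    obtain n where "n \<le> d" "spherical_harmonic n (harmonic d j)"
      by (rule spherical_harmonic_harmonic[OF j])
    then show ?thesis using assms(1) by (auto simp: exact_quadrature_def)
  qed
  have "(\<Sum>x\<in>X. of_real (w x) * f x) = (\<Sum>x\<in>X. \<Sum>j<?L. e j * (of_real (w x) * harmonic d j x))"
    using e assms(2) by (intro sum.cong) (auto simp: sum_distrib_left mult_ac)
  also have "\<dots> = (\<Sum>j<?L. e j * (\<Sum>x\<in>X. of_real (w x) * harmonic d j x))"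
    by (subst sum.swap) (simp add: sum_distrib_left)
  also have "\<dots> = (\<Sum>j<?L. e j * (LINT x|surface_measure. harmonic d j x))"
    by (simp add: q)
  also have "\<dots> = (LINT x|surface_measure. (\<Sum>j<?L. e j * harmonic d j x))"
    by (simp add: Bochner_Integration.integral_sum integrable_sphere_poly[OF sphere_poly_harmonic])
  also have "\<dots> = (LINT x|surface_measure. f x)"
    using e by (intro integral_S2_cong) simp
  finally show ?thesis .
qed

section \<open>The addition theorem on the diagonal\<close>

text \<open>
  Composition with \<open>T\<close> preserves both the polynomials of degree at most \<open>d\<close> and the inner product.
  It therefore acts on the orthonormal basis by a unitary matrix, and a unitary change of basis
  leaves the sum of the squared moduli unchanged. Taking all degrees up to \<open>d\<close> together is what makes
  the space obviously invariant.
\<close>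

lemma harmonic_kernel_orthogonal_invariant:
  assumes T: "orthogonal_transformation T" and x: "x \<in> S2"
  shows "(\<Sum>j<length (freq_indices d). harmonic d j (T x) * cnj (harmonic d j (T x)))
      = (\<Sum>j<length (freq_indices d). harmonic d j x * cnj (harmonic d j x))"
proof -
  define D where "D = length (freq_indices d)"
  have "\<forall>i. \<exists>u. i < D \<longrightarrow> (\<forall>x\<in>S2. harmonic d i (T x) = (\<Sum>j<D. u j * harmonic d j x))"
    using sphere_poly_harmonic_expansion[OF sphere_poly_orthogonal_comp[OF sphere_poly_harmonic T]]
    by (simp add: D_def)
  from choice[OF this] obtain u where
    u: "\<And>i x. i < D \<Longrightarrow> x \<in> S2 \<Longrightarrow> harmonic d i (T x) = (\<Sum>j<D. u i j * harmonic d j x)"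
    by blast
  \<comment> \<open>Inner products are computed in coordinates and are preserved by \<open>T\<close>.\<close>
  have rows: "(\<Sum>j<D. u i j * cnj (u k j)) = of_bool (i = k)" if ik: "i < D" "k < D" for i k
  proof -
    have "(\<Sum>j<D. u i j * cnj (u k j))
        = (LINT x|surface_measure. harmonic d i (T x) * cnj (harmonic d k (T x)))"
      unfolding D_def by (rule integral_harmonic_combinations[symmetric]) (use u ik in \<open>auto simp: D_def\<close>)
    also have "\<dots> = (LINT x|surface_measure. harmonic d i x * cnj (harmonic d k x))"
    proof (rule integral_orthogonal_comp[where f = "\<lambda>x. harmonic d i x * cnj (harmonic d k x)", OF _ T])
      show "sphere_poly (d + d) (\<lambda>x. harmonic d i x * cnj (harmonic d k x))"
        using ik by (intro sphere_poly_mult sphere_poly_cnj sphere_poly_harmonic) (simp_all add: D_def)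
    qed
    finally show ?thesis using ik by (simp add: harmonic_orthonormal D_def)
  qed
  \<comment> \<open>Expanding in the basis leaves inner products of the columns of \<open>u\<close>, which are orthonormal.\<close>
  have "(\<Sum>i<D. harmonic d i (T x) * cnj (harmonic d i (T x)))
      = (\<Sum>i<D. \<Sum>j<D. \<Sum>l<D. u i j * cnj (u i l) * (harmonic d j x * cnj (harmonic d l x)))"
    using x by (intro sum.cong refl) (simp add: u sum_product mult_ac)
  also have "\<dots> = (\<Sum>j<D. \<Sum>i<D. \<Sum>l<D. u i j * cnj (u i l) * (harmonic d j x * cnj (harmonic d l x)))"
    by (rule sum.swap)
  also have "\<dots> = (\<Sum>j<D. \<Sum>l<D. (\<Sum>i<D. u i j * cnj (u i l)) * (harmonic d j x * cnj (harmonic d l x)))"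
    unfolding sum_distrib_right by (rule sum.cong[OF refl], rule sum.swap)
  also have "\<dots> = (\<Sum>j<D. \<Sum>l<D. if l = j then harmonic d j x * cnj (harmonic d l x) else 0)"
    by (intro sum.cong refl) (simp add: orthonormal_rows_imp_orthonormal_columns[OF rows])
  finally show ?thesis by (simp add: D_def)
qed

text \<open>
  By transitivity of the orthogonal group the kernel is constant on the diagonal. Its integral is
  the number of basis functions, and the sphere has measure \<open>4 * pi\<close>.
\<close>

lemma harmonic_kernel_diagonal:
  assumes x: "x \<in> S2"
  shows "(\<Sum>j<length (freq_indices d). harmonic d j x * cnj (harmonic d j x))
      = of_real ((real d + 1)\<^sup>2 / (4 * pi))"
proof -
  define K where "K y = (\<Sum>j<length (freq_indices d). harmonic d j y * cnj (harmonic d j y))" for y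
  have const: "K y = K x" if "y \<in> S2" for y
  proof -
    have "norm x = norm y" using that x by simp
    then obtain T where "orthogonal_transformation T" "T x = y"
      by (rule orthogonal_transformation_exists)
    then show ?thesis
      using harmonic_kernel_orthogonal_invariant[OF _ x] by (auto simp: K_def)
  qed
  have "of_real (4 * pi) * K x = (LINT y|surface_measure. K x)"
    by (simp add: measure_surface_measure_S2 scaleR_conv_of_real)
  also have "\<dots> = (LINT y|surface_measure. K y)"
    by (intro integral_S2_cong) (simp add: const)
  also have "\<dots> = of_nat (length (freq_indices d))"
    by (simp add: K_def Bochner_Integration.integral_sum integrable_harmonic_mult_cnj harmonic_orthonormal)
  also have "\<dots> = of_real ((real d + 1)\<^sup>2)"
    by (simp add: length_freq_indices add.commute)
  finally have "K x = of_real ((real d + 1)\<^sup>2) / of_real (4 * pi)"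
    by (simp add: field_simps del: of_real_mult)
  then show ?thesis by (simp add: K_def)
qed

text \<open>
  The degree \<open>n\<close> part is the difference of two cumulative kernels:
  \<open>(n + 1)\<^sup>2 - n\<^sup>2 = 2 * n + 1\<close>.
\<close>

lemma addition_theorem_diagonal:
  assumes x: "x \<in> S2"
  shows "(\<Sum>k=- int n..int n. Y n k x * cnj (Y n k x)) = of_real ((2 * real n + 1) / (4 * pi))"
proof -
  have K: "(\<Sum>m\<le>d. \<Sum>k=- int m..int m. Y m k x * cnj (Y m k x)) = of_real ((real d + 1)\<^sup>2 / (4 * pi))" for d
    using harmonic_kernel_diagonal[OF x, of d]
      sum_freq_indices[of "\<lambda>(m, k). Y m k x * cnj (Y m k x)" d]
    by (simp add: harmonic_def case_prod_unfold)
  show ?thesis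
  proof (cases n)
    case 0
    then show ?thesis using K[of 0] by simp
  next
    case (Suc d)
    have "(\<Sum>k=- int n..int n. Y n k x * cnj (Y n k x))
        = of_real ((real n + 1)\<^sup>2 / (4 * pi)) - of_real ((real d + 1)\<^sup>2 / (4 * pi))"
      using K[of n] K[of d] by (simp add: Suc algebra_simps del: of_real_divide of_real_mult)
    also have "\<dots> = of_real (((real n + 1)\<^sup>2 - (real d + 1)\<^sup>2) / (4 * pi))"
      by (simp add: diff_divide_distrib)
    also have "(real n + 1)\<^sup>2 - (real d + 1)\<^sup>2 = 2 * real n + 1"
      by (simp add: Suc power2_eq_square algebra_simps)
    finally show ?thesis .
  qed
qed

end

section \<open>The hat matrix\<close>

context spherical_harmonics_basis
begin

lemma fourier_matrix_eq:
  "fourier_matrix Y N xs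
    = Matrix.mat (length xs) (length (freq_indices N)) (\<lambda>(i, j). harmonic N j (xs ! i))"
  by (rule eq_matI) (auto simp: fourier_matrix_def harmonic_def case_prod_unfold)

text \<open>
  An entry of this matrix is the quadrature of a product of two basis functions, one of them
  conjugated. The product has degree at most \<open>2 * N\<close>, so the quadrature returns the inner product.
\<close>

lemma discrete_orthonormality:
  assumes X: "distinct xs" "set xs \<subseteq> S2" and quad: "exact_quadrature (set xs) w (2 * N)"
  shows "mat_adjoint (fourier_matrix Y N xs) * weight_matrix w xs * fourier_matrix Y N xs
      = 1\<^sub>m (length (freq_indices N))"
proof -
  let ?F = "fourier_matrix Y N xs" and ?L = "length (freq_indices N)" and ?m = "length xs"
  have adj: "mat_adjoint ?F \<in> carrier_mat ?L ?m"
    by (simp add: mat_adjoint_eq_mat fourier_matrix_eq)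
  have entry: "(\<Sum>i<?m. cnj (harmonic N j (xs ! i)) * of_real (w (xs ! i)) * harmonic N l (xs ! i))
      = of_bool (j = l)" if "j < ?L" "l < ?L" for j l
  proof -
    have poly: "sphere_poly (2 * N) (\<lambda>x. harmonic N l x * cnj (harmonic N j x))"
      using sphere_poly_mult[OF sphere_poly_harmonic sphere_poly_cnj[OF sphere_poly_harmonic]] that
      by (simp add: mult_2)
    have "(\<Sum>i<?m. cnj (harmonic N j (xs ! i)) * of_real (w (xs ! i)) * harmonic N l (xs ! i))
        = (\<Sum>x\<in>set xs. cnj (harmonic N j x) * of_real (w x) * harmonic N l x)"
      by (rule sum.reindex_bij_betw[OF bij_betw_nth]) (auto simp: X)
    also have "\<dots> = (\<Sum>x\<in>set xs. of_real (w x) * (harmonic N l x * cnj (harmonic N j x)))"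
      by (simp add: mult_ac)
    also have "\<dots> = (LINT x|surface_measure. harmonic N l x * cnj (harmonic N j x))"
      using exact_quadrature_sphere_poly[OF quad X(2) poly] .
    also have "\<dots> = of_bool (l = j)"
      by (rule harmonic_orthonormal[OF that(2,1)])
    finally show ?thesis by (simp add: eq_commute[of l j])
  qed
  have "mat_adjoint ?F * weight_matrix w xs
      = Matrix.mat ?L ?m (\<lambda>(j, i). cnj (harmonic N j (xs ! i)) * of_real (w (xs ! i)))"
    unfolding weight_matrix_def mat_diag_mult_right[OF adj]
    by (rule eq_matI) (auto simp: mat_adjoint_eq_mat fourier_matrix_eq)
  then show ?thesis
    by (intro eq_matI) (auto simp: fourier_matrix_eq scalar_prod_def atLeast0LessThan entry)
qed

lemma normal_matrix_eq_mat_diag: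
  assumes "distinct xs" "set xs \<subseteq> S2" "exact_quadrature (set xs) w (2 * N)"
  shows "normal_matrix Y N lam w wh xs = mat_diag (length (freq_indices N))
      (\<lambda>j. of_real (1 + lam * wh (fst (freq_indices N ! j))))"
  unfolding normal_matrix_def Let_def discrete_orthonormality[OF assms]
  by (rule eq_matI) (auto simp: freq_weight_matrix_def mat_diag_def)

lemma hat_matrix_diagonal_entry:
  assumes inv: "mat_inverse (normal_matrix Y N lam w wh xs)
      = Some (mat_diag (length (freq_indices N)) r)"
    and i: "i < length xs"
  shows "hat_matrix Y N lam w wh xs $$ (i, i) = of_real (w (xs ! i)) *
      (\<Sum>j<length (freq_indices N). r j * (harmonic N j (xs ! i) * cnj (harmonic N j (xs ! i))))"
proof -
  let ?F = "fourier_matrix Y N xs" and ?L = "length (freq_indices N)" and ?m = "length xs"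
  have F: "?F \<in> carrier_mat ?m ?L" by (simp add: fourier_matrix_eq)
  have FR: "?F * mat_diag ?L r = Matrix.mat ?m ?L (\<lambda>(i, j). harmonic N j (xs ! i) * r j)"
    unfolding mat_diag_mult_right[OF F] by (rule eq_matI) (auto simp: fourier_matrix_eq)
  have "?F * mat_diag ?L r * mat_adjoint ?F \<in> carrier_mat ?m ?m"
    by (intro mult_carrier_mat[of _ _ ?L] F mat_diag_dim) (simp add: mat_adjoint_eq_mat fourier_matrix_eq)
  then have "hat_matrix Y N lam w wh xs $$ (i, i)
      = (?F * mat_diag ?L r * mat_adjoint ?F) $$ (i, i) * of_real (w (xs ! i))"
    using i by (simp add: hat_matrix_def Let_def inv weight_matrix_def mat_diag_mult_right)
  also have "(?F * mat_diag ?L r * mat_adjoint ?F) $$ (i, i)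
      = (\<Sum>j<?L. harmonic N j (xs ! i) * r j * cnj (harmonic N j (xs ! i)))"
    unfolding FR using i
    by (simp add: mat_adjoint_eq_mat fourier_matrix_eq scalar_prod_def atLeast0LessThan)
  finally show ?thesis by (simp add: mult_ac)
qed

end

theorem theorem5p1:
  fixes Y :: "nat \<Rightarrow> int \<Rightarrow> real ^ 3 \<Rightarrow> complex"
    and N :: nat
    and lam :: real
    and X :: "(real ^ 3) set"
    and xs :: "(real ^ 3) list"
    and w :: "real ^ 3 \<Rightarrow> real"
    and wh :: "nat \<Rightarrow> real"
  assumes "spherical_harmonics_onb Y"
    and "lam > 0"
    and "finite X" and "X \<subseteq> S2"
    and "distinct xs" and "set xs = X"
    and "\<And>x. x \<in> X \<Longrightarrow> w x > 0"
    and "\<And>n. n \<le> N \<Longrightarrow> wh n > 0"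
    and "exact_quadrature X w (2 * N)"
  shows "invertible_mat (normal_matrix Y N lam w wh xs) \<and>
    (\<forall>i < length xs. hat_matrix Y N lam w wh xs $$ (i, i) =
       complex_of_real (w (xs ! i) / (4 * pi) * (\<Sum>n = 0..N. real (2 * n + 1) / (1 + lam * wh n))))"
proof -
  interpret spherical_harmonics_basis Y by standard fact
  let ?L = "length (freq_indices N)"
  define s where "s n = complex_of_real (1 + lam * wh n)" for n
  define r where "r j = 1 / s (fst (freq_indices N ! j))" for j
  let ?A = "normal_matrix Y N lam w wh xs"
  have s: "s n \<noteq> 0" if "n \<le> N" for n
  proof -
    have "1 + lam * wh n > 0" using assms(2) assms(8)[OF that] by (simp add: add_pos_pos)
    then show ?thesis by (simp only: s_def of_real_eq_0_iff)
  qed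
  have s_freq: "s (fst (freq_indices N ! j)) \<noteq> 0" if "j < ?L" for j
    using nth_mem[OF that] s by (auto simp: set_freq_indices)
  have A: "?A = mat_diag ?L (\<lambda>j. s (fst (freq_indices N ! j)))"
    using normal_matrix_eq_mat_diag[of xs w N lam wh] assms(4-6,9) by (simp add: s_def)
  have AR: "?A * mat_diag ?L r = 1\<^sub>m ?L"
    unfolding A mat_diag_diag by (rule eq_matI) (auto simp: mat_diag_def r_def s_freq)
  have RA: "mat_diag ?L r * ?A = 1\<^sub>m ?L"
    unfolding A mat_diag_diag by (rule eq_matI) (auto simp: mat_diag_def r_def s_freq)
  have dims: "?A \<in> carrier_mat ?L ?L" by (simp add: A)
  then have "invertible_mat ?A"
    using AR RA unfolding invertible_mat_def inverts_mat_def
    by (metis carrier_matD mat_diag_dim square_mat.elims(3))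
  moreover have "hat_matrix Y N lam w wh xs $$ (i, i) =
      complex_of_real (w (xs ! i) / (4 * pi) * (\<Sum>n = 0..N. real (2 * n + 1) / (1 + lam * wh n)))"
    if i: "i < length xs" for i
  proof -
    let ?x = "xs ! i"
    have x: "?x \<in> S2" using i assms(4,6) nth_mem by blast
    have "hat_matrix Y N lam w wh xs $$ (i, i)
        = of_real (w ?x) * (\<Sum>j<?L. r j * (harmonic N j ?x * cnj (harmonic N j ?x)))"
      by (rule hat_matrix_diagonal_entry[OF mat_inverse_eqI[OF dims mat_diag_dim AR] i])
    also have "(\<Sum>j<?L. r j * (harmonic N j ?x * cnj (harmonic N j ?x)))
        = (\<Sum>n\<le>N. \<Sum>k=- int n..int n. 1 / s n * (Y n k ?x * cnj (Y n k ?x)))"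
      using sum_freq_indices[of "\<lambda>(n, k). 1 / s n * (Y n k ?x * cnj (Y n k ?x))" N]
      by (simp add: r_def harmonic_def case_prod_unfold)
    also have "\<dots> = (\<Sum>n\<le>N. 1 / s n * of_real ((2 * real n + 1) / (4 * pi)))"
      by (simp only: sum_distrib_left[symmetric] addition_theorem_diagonal[OF x])
    also have "\<dots> = of_real (\<Sum>n = 0..N. 1 / (4 * pi) * (real (2 * n + 1) / (1 + lam * wh n)))"
      by (simp add: s_def atMost_atLeast0 mult.commute add.commute)
    also have "\<dots> = of_real (1 / (4 * pi) * (\<Sum>n = 0..N. real (2 * n + 1) / (1 + lam * wh n)))"
      by (simp only: sum_distrib_left)
    finally show ?thesis by simp
  qed
  ultimately show ?thesis by blast
qed

end
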